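(* Let $\mathbf E$ be an $n$-dimensional nilpotent evolution algebra of maximal nilindex in the normal form given in the context. Let $D\in\mathrm{Der}(\mathbf E)$ and let $R\in\mathrm{RB}_0(\mathbf E)$ be written with parameters $\beta_i,\lambda$ (and threshold $k$) as in the context. (1) Suppose $\mathcal I_A\ne\varnothing$. Write $D(\mathbf e_1)=\nu\mathbf e_n$, $D(\mathbf e_i)=0$ $(2\le i\le n)$. Then $$[R,D]=0\iff \nu\lambda=0.$$ Thus, if $\nu=0$, every operator in $\mathrm{RB}_0(\mathbf E)$ commutes with $D$; if $\nu\ne0$, the operators in $\mathrm{RB}_0(\mathbf E)$ commuting with $D$ are exactly the annihilator-valued operators with $R(\mathbf e_n)=0$. (2) Suppose $\mathcal I_A=\varnothing$. Write $D(\mathbf e_1)=\mu\mathbf e_1+\nu\mathbf e_n$, $D(\mathbf e_i)=2^{i-1}\mu\mathbf e_i$ $(2\le i\le n)$, and put $\tau_1=\nu$, $\tau_i=0$ $(2\le i<n)$. If $R$ is annihilator-valued, say $R(\mathbf e_i)=\beta_i\mathbf e_n$ $(1\le i<n)$, $R(\mathbf e_n)=\lambda\mathbf e_n$, then $[R,D]=0$ if and only if $$\beta_i(2^{i-1}-2^{n-1})\mu+\tau_i\lambda=0\qquad(1\le i<n).$$ If $R$ has nonzero threshold $k<n$, then $[R,D]=0$ if and only if $$\beta_i(2^{i-1}-2^{n-1})\mu+\tau_i\lambda=0\qquad(1\le i<k)$$ and $$\beta_k(2^{k-1}-2^{n-1})\mu+(1-2^{n-k})\tau_k\lambda=0.$$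 There are no further conditions for $k<i<n$: for those indices $[R,D](\mathbf e_i)=0$ automatically.
   Context: $\mathbb K$ is a field of characteristic zero and $n\ge 3$. An evolution algebra is an algebra with a basis $\{\mathbf e_1,\dots,\mathbf e_n\}$ (a natural basis) such that $\mathbf e_i\mathbf e_j=0$ for $i\ne j$. Every $n$-dimensional nilpotent evolution algebra of maximal nilindex over $\mathbb K$ admits a natural basis with $$\mathbf e_i^2=\mathbf e_{i+1}+\sum_{j=i+2}^{n-1}a_{ij}\mathbf e_j\ (1\le i\le n-3),\quad \mathbf e_{n-2}^2=\mathbf e_{n-1},\quad \mathbf e_{n-1}^2=\mathbf e_n,\quad \mathbf e_n^2=0,$$ with $a_{ij}\in\mathbb K$; $\mathbf E$ denotes such an algebra with this fixed basis (the normal form). Put $\mathcal I_A=\{(i,j): i+1<j<n,\ a_{ij}\ne0\}$, and define $i_0=0$ if $\mathcal I_A=\varnothing$, and $i_0=\max\{i:(i,j)\in\mathcal I_A\text{ for some }j\}$ otherwise. $\mathrm{RB}_0(\mathbf E)$ is the set of linear maps $R:\mathbf E\to\mathbf E$ with $R(x)R(y)=R(R(x)y+xR(y))$ for all $x,y\in\mathbf E$. Known classification: $R\in\mathrm{RB}_0(\mathbf E)$ if and only if exactly one of the following holds. (i) Annihilator-valued case: there are $\beta_1,\dots,\beta_{n-1},\lambda\in\mathbb K$ with $R(\mathbf e_i)=\beta_i\mathbf e_n$ $(1\le i<n)$ and $R(\mathbf e_n)=\lambda\mathbf e_n$. (ii) Nonzero threshold case: there are $k\in\{i_0+1,\dots,n-1\}$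 (the threshold), $\lambda\in\mathbb K\setminus\{0\}$ and $\beta_1,\dots,\beta_k\in\mathbb K$ with $R(\mathbf e_i)=\beta_i\mathbf e_n$ for $1\le i<k$, $R(\mathbf e_k)=2^{n-k}\lambda\mathbf e_k+\beta_k\mathbf e_n$, and $R(\mathbf e_i)=2^{n-i}\lambda\mathbf e_i$ for $k<i\le n$. In both cases $\lambda$ is the coefficient of $\mathbf e_n$ in $R(\mathbf e_n)$. $\mathrm{Der}(\mathbf E)$ is the space of derivations of $\mathbf E$. Known: if $\mathcal I_A\ne\varnothing$, every $D\in\mathrm{Der}(\mathbf E)$ has the form $D(\mathbf e_1)=\nu\mathbf e_n$, $D(\mathbf e_i)=0$ for $2\le i\le n$, with $\nu\in\mathbb K$; if $\mathcal I_A=\varnothing$, every $D\in\mathrm{Der}(\mathbf E)$ has the form $D(\mathbf e_1)=\mu\mathbf e_1+\nu\mathbf e_n$, $D(\mathbf e_i)=2^{i-1}\mu\mathbf e_i$ for $2\le i\le n$, with $\mu,\nu\in\mathbb K$. The commutator is $[S,T]=ST-TS$. *)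

theory Defs
  imports Complex_Main
begin

text \<open>
  Algebras are not assumed associative, commutative or unital. The underlying vector space is the
  whole type \<open>'v\<close>; its dimension is fixed by a basis indexed by \<open>{1..n}\<close>.
\<close>

locale nonassoc_algebra = vector_space scale
  for scale :: "'k::field \<Rightarrow> 'v::ab_group_add \<Rightarrow> 'v" (infixr "*s" 75) +
  fixes mult :: "'v \<Rightarrow> 'v \<Rightarrow> 'v" (infixl "\<odot>" 70)
  assumes linear_mult_right: "Vector_Spaces.linear (*s) (*s) (\<lambda>y. x \<odot> y)"
    and linear_mult_left: "Vector_Spaces.linear (*s) (*s) (\<lambda>x. x \<odot> y)"
begin

definition natural_basis :: "nat \<Rightarrow> (nat \<Rightarrow> 'v) \<Rightarrow> bool" where
  "natural_basis n e \<longleftrightarrow>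
     inj_on e {1..n} \<and> independent (e ` {1..n}) \<and> span (e ` {1..n}) = UNIV \<and>
     (\<forall>i\<in>{1..n}. \<forall>j\<in>{1..n}. i \<noteq> j \<longrightarrow> e i \<odot> e j = 0)"

definition evolution_algebra :: "nat \<Rightarrow> bool" where
  "evolution_algebra n \<longleftrightarrow> (\<exists>e. natural_basis n e)"

text \<open>
  The lower central powers \<open>E\<^sup>1 = E\<close> and \<open>E\<^sup>m = \<Sum>i=1..m-1. E\<^sup>i E\<^sup>(\<^sup>m\<^sup>-\<^sup>i\<^sup>)\<close>, where a product of subspaces is
  the span of the pairwise products. The value at \<open>m = 0\<close> is a convention and is never used.
\<close>

fun algebra_power :: "nat \<Rightarrow> 'v set" where
  "algebra_power m =
     (if m \<le> 1 then UNIV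
      else span (\<Union>i\<in>{1..<m}. (\<lambda>(x, y). x \<odot> y) ` (algebra_power i \<times> algebra_power (m - i))))"

declare algebra_power.simps [simp del]

definition nilpotent :: bool where
  "nilpotent \<longleftrightarrow> (\<exists>m\<ge>1. algebra_power m = {0})"

definition nilindex :: nat where
  "nilindex = (LEAST m. m \<ge> 1 \<and> algebra_power m = {0})"

definition Der :: "('v \<Rightarrow> 'v) set" where
  "Der = {D. Vector_Spaces.linear (*s) (*s) D \<and>
             (\<forall>x y. D (x \<odot> y) = D x \<odot> y + x \<odot> D y)}"

definition RB0 :: "('v \<Rightarrow> 'v) set" where
  "RB0 = {R. Vector_Spaces.linear (*s) (*s) R \<and>
             (\<forall>x y. R x \<odot> R y = R (R x \<odot> y + x \<odot> R y))}"

end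

text \<open>
  Maximality of the nilindex is among all \<open>n\<close>-dimensional nilpotent evolution algebras over the
  field. Any such algebra can be transported to the underlying space of the given one, so it
  suffices to compare the multiplications on that space.
\<close>

definition max_nilindex_evolution_algebra ::
    "('k::field \<Rightarrow> 'v::ab_group_add \<Rightarrow> 'v) \<Rightarrow> ('v \<Rightarrow> 'v \<Rightarrow> 'v) \<Rightarrow> nat \<Rightarrow> bool" where
  "max_nilindex_evolution_algebra scale mult n \<longleftrightarrow>
     nonassoc_algebra scale mult \<and>
     nonassoc_algebra.evolution_algebra scale mult n \<and>
     nonassoc_algebra.nilpotent scale mult \<and>
     (\<forall>mult'. nonassoc_algebra scale mult' \<and>
              nonassoc_algebra.evolution_algebra scale mult' n \<and>
              nonassoc_algebra.nilpotent scale mult' \<longrightarrow>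
              nonassoc_algebra.nilindex scale mult' \<le> nonassoc_algebra.nilindex scale mult)"

text \<open>Only the entries \<open>a i j\<close> with \<open>1 \<le> i\<close> and \<open>i + 1 < j < n\<close> are structure constants.\<close>

definition normal_form ::
    "('k::field \<Rightarrow> 'v::ab_group_add \<Rightarrow> 'v) \<Rightarrow> ('v \<Rightarrow> 'v \<Rightarrow> 'v) \<Rightarrow> nat \<Rightarrow>
     (nat \<Rightarrow> 'v) \<Rightarrow> (nat \<Rightarrow> nat \<Rightarrow> 'k) \<Rightarrow> bool" where
  "normal_form scale mult n e a \<longleftrightarrow>
     nonassoc_algebra.natural_basis scale mult n e \<and>
     (\<forall>i\<in>{1..n-3}. mult (e i) (e i) = e (i+1) + (\<Sum>j=i+2..n-1. scale (a i j) (e j))) \<and>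
     mult (e (n-2)) (e (n-2)) = e (n-1) \<and>
     mult (e (n-1)) (e (n-1)) = e n \<and>
     mult (e n) (e n) = 0"

definition index_set :: "nat \<Rightarrow> (nat \<Rightarrow> nat \<Rightarrow> 'k::field) \<Rightarrow> (nat \<times> nat) set" where
  "index_set n a = {(i, j). 1 \<le> i \<and> i + 1 < j \<and> j < n \<and> a i j \<noteq> 0}"

definition i0 :: "nat \<Rightarrow> (nat \<Rightarrow> nat \<Rightarrow> 'k::field) \<Rightarrow> nat" where
  "i0 n a = (if index_set n a = {} then 0 else Max {i. \<exists>j. (i, j) \<in> index_set n a})"

text \<open>
  The two shapes that occur in the classification of Rota--Baxter operators of weight zero. The
  value of \<open>\<beta>\<close> outside \<open>{1..<n}\<close>, respectively \<open>{1..k}\<close>, is irrelevant.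
\<close>

definition annihilator_valued ::
    "('k::field \<Rightarrow> 'v::ab_group_add \<Rightarrow> 'v) \<Rightarrow> nat \<Rightarrow> (nat \<Rightarrow> 'v) \<Rightarrow>
     (nat \<Rightarrow> 'k) \<Rightarrow> 'k \<Rightarrow> ('v \<Rightarrow> 'v) \<Rightarrow> bool" where
  "annihilator_valued scale n e \<beta> lam R \<longleftrightarrow>
     Vector_Spaces.linear scale scale R \<and>
     (\<forall>i\<in>{1..<n}. R (e i) = scale (\<beta> i) (e n)) \<and> R (e n) = scale lam (e n)"

definition nonzero_threshold ::
    "('k::field \<Rightarrow> 'v::ab_group_add \<Rightarrow> 'v) \<Rightarrow> nat \<Rightarrow> (nat \<Rightarrow> 'v) \<Rightarrow> (nat \<Rightarrow> nat \<Rightarrow> 'k) \<Rightarrow>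
     nat \<Rightarrow> (nat \<Rightarrow> 'k) \<Rightarrow> 'k \<Rightarrow> ('v \<Rightarrow> 'v) \<Rightarrow> bool" where
  "nonzero_threshold scale n e a k \<beta> lam R \<longleftrightarrow>
     Vector_Spaces.linear scale scale R \<and>
     k \<in> {i0 n a + 1..n - 1} \<and> lam \<noteq> 0 \<and>
     (\<forall>i\<in>{1..<k}. R (e i) = scale (\<beta> i) (e n)) \<and>
     R (e k) = scale (2 ^ (n - k) * lam) (e k) + scale (\<beta> k) (e n) \<and>
     (\<forall>i\<in>{k<..n}. R (e i) = scale (2 ^ (n - i) * lam) (e i))"

definition basis_coeff ::
    "('k::field \<Rightarrow> 'v::ab_group_add \<Rightarrow> 'v) \<Rightarrow> nat \<Rightarrow> (nat \<Rightarrow> 'v) \<Rightarrow> nat \<Rightarrow> 'v \<Rightarrow> 'k" where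
  "basis_coeff scale n e i x = module.representation scale (e ` {1..n}) x (e i)"

definition commutator :: "('v::ab_group_add \<Rightarrow> 'v) \<Rightarrow> ('v \<Rightarrow> 'v) \<Rightarrow> 'v \<Rightarrow> 'v" where
  "commutator S T = (\<lambda>x. S (T x) - T (S x))"

end

theory Submission
  imports Defs
begin

text \<open>
  The part of the classification of \<open>RB0\<close> that governs commutators is that an operator \<open>R\<close> in
  it is diagonal up to values in the annihilator, the line of \<open>e n\<close>:
  \<open>R (e i) = d i *s e i + \<beta> i *s e n\<close>. The reason is triangularity. Every product is a combination
  of the squares \<open>e m \<odot> e m\<close> with \<open>m < n\<close>, which are triangular with respect to the basis
  because \<open>e m \<odot> e m\<close> has leading term \<open>e (m + 1)\<close>. The Rota--Baxter identity on a pair of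
  basis vectors equates one such combination, whose coefficients are products of matrix entries
  of \<open>R\<close>, with the image under \<open>R\<close> of another. For the pair \<open>(e n, e n)\<close> the right-hand side
  vanishes, so the squares of the entries of \<open>R (e n)\<close> away from \<open>e n\<close> vanish
  (\<open>diagonal_at_last\<close>). Going down from \<open>i + 1\<close> to \<open>i\<close>, the identity on \<open>(e i, e i)\<close>
  kills the entries of \<open>R (e i)\<close> at indices below \<open>i\<close> and gives \<open>d i = 0\<close> or
  \<open>d i = 2 * d (i + 1)\<close>. If \<open>d i = 0\<close> it also kills those between \<open>i\<close> and \<open>n\<close>; otherwise the
  identity on \<open>(e i, e j)\<close> with \<open>i < j < n\<close> does so, because the nonzero consecutive diagonal
  entries \<open>d j\<close> and \<open>d (j + 1)\<close> differ (\<open>diagonal_at_step\<close>).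

  Two consequences matter. If \<open>d n = 0\<close> then all \<open>d i\<close> vanish, so \<open>R\<close> is
  annihilator-valued. If \<open>d i \<noteq> 0\<close>, comparing the coefficients of \<open>e j\<close> with \<open>j > i + 1\<close> in the
  identity on \<open>(e i, e i)\<close> forces \<open>a i j = 0\<close>, as \<open>d (i + 1)\<close> and \<open>d j\<close> differ by a nontrivial
  power of two; hence \<open>d 1 = 0\<close> as soon as some structure constant \<open>a i j\<close> is nonzero
  (\<open>RB0_first_diag_entry_zero\<close>).

  The derivations have the same shape \<open>D (e i) = \<delta> i *s e i + \<tau> i *s e n\<close>, and for two maps of
  this shape the commutator sends \<open>e i\<close> to
  \<open>(\<beta> i * (\<delta> i - \<delta> n) + \<tau> i * (d n - d i)) *s e n\<close> (\<open>commutator_basis\<close>). All parts of the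
  theorem are specialisations of this formula. For a nonempty index set, \<open>\<delta> = 0\<close>, only \<open>\<tau> 1 = \<nu>\<close>
  can be nonzero, and \<open>d 1 = 0\<close> leaves the single condition \<open>\<nu> * d n = 0\<close>.
\<close>

section \<open>Coordinates in the normal form\<close>

lemma sum_eq_single:
  fixes h :: "'b \<Rightarrow> 'c::comm_monoid_add"
  assumes "finite J" "i \<in> J" "\<And>m. m \<in> J \<Longrightarrow> m \<noteq> i \<Longrightarrow> h m = 0"
  shows "sum h J = h i"
  using sum.mono_neutral_right[of J "{i}" h] assms by auto

locale normal_form_algebra = nonassoc_algebra scale mult
  for scale :: "'k::field_char_0 \<Rightarrow> 'v::ab_group_add \<Rightarrow> 'v" (infixr "*s" 75)
    and mult :: "'v \<Rightarrow> 'v \<Rightarrow> 'v" (infixl "\<odot>" 70) +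
  fixes n :: nat and e :: "nat \<Rightarrow> 'v" and a :: "nat \<Rightarrow> nat \<Rightarrow> 'k"
  assumes n_ge_3: "n \<ge> 3"
    and normal_form: "normal_form scale mult n e a"
begin

abbreviation coord :: "nat \<Rightarrow> 'v \<Rightarrow> 'k" where
  "coord i x \<equiv> basis_coeff scale n e i x"

lemma natural_basis: "natural_basis n e"
  using normal_form by (simp add: normal_form_def)

lemma inj_basis: "inj_on e {1..n}"
  and independent_basis: "independent (e ` {1..n})"
  and span_basis: "span (e ` {1..n}) = UNIV"
  using natural_basis by (auto simp: natural_basis_def)

lemma mult_distinct: "i \<in> {1..n} \<Longrightarrow> j \<in> {1..n} \<Longrightarrow> i \<noteq> j \<Longrightarrow> e i \<odot> e j = 0"
  using natural_basis by (auto simp: natural_basis_def)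

lemma coord_add [simp]: "coord i (x + y) = coord i x + coord i y"
  using independent_basis span_basis by (simp add: basis_coeff_def representation_add)

lemma coord_scale [simp]: "coord i (r *s x) = r * coord i x"
  using independent_basis span_basis by (simp add: basis_coeff_def representation_scale)

lemma coord_zero [simp]: "coord i 0 = 0"
  unfolding basis_coeff_def by (simp add: representation_zero)

lemma coord_sum [simp]: "coord i (\<Sum>j\<in>J. x j) = (\<Sum>j\<in>J. coord i (x j))"
  by (induction J rule: infinite_finite_induct) auto

lemma coord_basis:
  assumes "i \<in> {1..n}" "j \<in> {1..n}"
  shows "coord i (e j) = (if i = j then 1 else 0)"
  using assms inj_basis independent_basis
  by (auto simp: basis_coeff_def representation_basis dest: inj_onD)

lemma basis_expansion: "x = (\<Sum>i\<in>{1..n}. coord i x *s e i)"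
proof -
  have "(\<Sum>v\<in>e ` {1..n}. representation (e ` {1..n}) x v *s v) = x"
    by (rule sum_representation_eq) (use independent_basis span_basis in auto)
  then show ?thesis
    by (simp add: sum.reindex[OF inj_basis] basis_coeff_def del: One_nat_def)
qed

lemma eq_if_coord_eq: "(\<And>p. p \<in> {1..n} \<Longrightarrow> coord p x = coord p y) \<Longrightarrow> x = y"
  using basis_expansion[of x] basis_expansion[of y]
  by (metis (no_types, lifting) sum.cong)

lemma linear_expansion:
  assumes "Vector_Spaces.linear scale scale f"
  shows "f x = (\<Sum>i\<in>{1..n}. coord i x *s f (e i))"
proof -
  interpret f: Vector_Spaces.linear scale scale f by fact
  have "f x = f (\<Sum>i\<in>{1..n}. coord i x *s e i)"
    using basis_expansion[of x] by simp
  then show ?thesis by (simp add: f.sum f.scale)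
qed

abbreviation square :: "nat \<Rightarrow> 'v" where
  "square i \<equiv> e i \<odot> e i"

lemma mult_basis_right:
  assumes "j \<in> {1..n}"
  shows "x \<odot> e j = coord j x *s square j"
proof -
  have "x \<odot> e j = (\<Sum>i\<in>{1..n}. coord i x *s (e i \<odot> e j))"
    by (rule linear_expansion) (rule linear_mult_left)
  also have "\<dots> = (\<Sum>i\<in>{1..n}. if i = j then coord j x *s square j else 0)"
    by (rule sum.cong) (use assms mult_distinct in auto)
  also have "\<dots> = coord j x *s square j"
    using assms by simp
  finally show ?thesis .
qed

lemma mult_basis_left:
  assumes "j \<in> {1..n}"
  shows "e j \<odot> x = coord j x *s square j"
proof -
  have "e j \<odot> x = (\<Sum>i\<in>{1..n}. coord i x *s (e j \<odot> e i))"
    by (rule linear_expansion) (rule linear_mult_right)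
  also have "\<dots> = (\<Sum>i\<in>{1..n}. if i = j then coord j x *s square j else 0)"
    by (rule sum.cong) (use assms mult_distinct in auto)
  also have "\<dots> = coord j x *s square j"
    using assms by simp
  finally show ?thesis .
qed

lemma square_last: "square n = 0"
  using normal_form by (simp add: normal_form_def)

lemma mult_expansion: "x \<odot> y = (\<Sum>m\<in>{1..<n}. (coord m x * coord m y) *s square m)"
proof -
  have "x \<odot> y = (\<Sum>m\<in>{1..n}. coord m y *s (x \<odot> e m))"
    by (rule linear_expansion) (rule linear_mult_right)
  also have "\<dots> = (\<Sum>m\<in>{1..n}. (coord m x * coord m y) *s square m)"
    by (rule sum.cong) (auto simp: mult_basis_right[of _ x] mult.commute)
  also have "\<dots> = (\<Sum>m\<in>{1..<n}. (coord m x * coord m y) *s square m)"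
    using n_ge_3 square_last by (simp add: sum.last_plus)
  finally show ?thesis .
qed

lemma square_expansion:
  assumes "i \<in> {1..<n}"
  shows "square i = e (i + 1) + (\<Sum>j=i+2..n-1. a i j *s e j)"
proof -
  consider "i \<in> {1..n-3}" | "i = n - 2" "\<not> i \<le> n - 3" | "i = n - 1" "\<not> i \<le> n - 3"
    using assms n_ge_3 by force
  then show ?thesis
    using normal_form n_ge_3 by cases (auto simp: normal_form_def numeral_eq_Suc Suc_diff_Suc)
qed

lemma coord_square:
  assumes "i \<in> {1..<n}" "p \<in> {1..n}"
  shows "coord p (square i) =
    (if p = i + 1 then 1 else if i + 1 < p \<and> p < n then a i p else 0)"
proof -
  have "coord p (\<Sum>j=i+2..n-1. a i j *s e j) = (\<Sum>j=i+2..n-1. if j = p then a i p else 0)"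
    unfolding coord_sum by (rule sum.cong) (use assms in \<open>auto simp: coord_basis\<close>)
  also have "\<dots> = (if p \<in> {i+2..n-1} then a i p else 0)"
    by simp
  finally show ?thesis
    using assms by (auto simp: square_expansion coord_basis)
qed

text \<open>
  A triangular form of the linear independence of the squares. It is applied with coefficients
  that are squares of matrix entries, and with \<open>q < n\<close> when only the lower coordinates of the
  combination are known to vanish.
\<close>

lemma square_combination_leading:
  assumes "\<And>p. p \<in> {1..q} \<Longrightarrow> (\<Sum>m\<in>{1..<n}. g m * coord p (square m)) = 0"
    and "q \<le> n" "m \<in> {1..<q}"
  shows "g m = 0"
  using \<open>m \<in> {1..<q}\<close>
proof (induction m rule: less_induct)
  case (less m)
  \<comment> \<open>At \<open>e (m + 1)\<close> the later squares do not contribute, and the earlier ones have coefficient 0.\<close>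
  have "(\<Sum>l\<in>{1..<n}. g l * coord (m + 1) (square l)) = (\<Sum>l\<in>{1..<n}. if l = m then g m else 0)"
  proof (rule sum.cong)
    fix l assume "l \<in> {1..<n}"
    then show "g l * coord (m + 1) (square l) = (if l = m then g m else 0)"
      using less \<open>q \<le> n\<close> by (cases l m rule: linorder_cases) (auto simp: coord_square)
  qed simp
  then show ?case
    using assms(1)[of "m + 1"] less.prems \<open>q \<le> n\<close> by (simp split: if_splits)
qed

section \<open>Rota--Baxter operators are diagonal modulo the annihilator\<close>

lemma RB0_linear: "R \<in> RB0 \<Longrightarrow> Vector_Spaces.linear scale scale R"
  by (simp add: RB0_def)

text \<open>
  The Rota--Baxter identity on two basis vectors, in coordinates: multiplying by a basis vector
  picks out a single coordinate, so the right-hand side involves only two squares.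
\<close>

lemma RB0_basis:
  assumes "R \<in> RB0" "i \<in> {1..n}" "j \<in> {1..n}"
  shows "(\<Sum>m\<in>{1..<n}. coord m (R (e i)) * coord m (R (e j)) * coord p (square m)) =
    coord j (R (e i)) * coord p (R (square j)) + coord i (R (e j)) * coord p (R (square i))"
proof -
  interpret R: Vector_Spaces.linear scale scale R
    using RB0_linear assms(1) .
  have "coord p (R (e i) \<odot> R (e j)) = coord p (R (R (e i) \<odot> e j + e i \<odot> R (e j)))"
    using assms(1) by (simp add: RB0_def)
  then show ?thesis
    using assms by (simp add: mult_expansion[of "R (e i)" "R (e j)"]
        mult_basis_left[of i "R (e j)"] mult_basis_right[of j "R (e i)"] R.add R.scale)
qed

text \<open>
  Membership of \<open>R (e j)\<close> in the span of \<open>e j\<close> and \<open>e n\<close>, phrased by coordinates so that the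
  case \<open>j = n\<close> is included.
\<close>

definition diagonal_at :: "('v \<Rightarrow> 'v) \<Rightarrow> nat \<Rightarrow> bool" where
  "diagonal_at R j \<longleftrightarrow> (\<forall>p\<in>{1..<n}. p \<noteq> j \<longrightarrow> coord p (R (e j)) = 0)"

abbreviation diag_entry :: "('v \<Rightarrow> 'v) \<Rightarrow> nat \<Rightarrow> 'k" where
  "diag_entry R j \<equiv> coord j (R (e j))"

lemma diagonal_at_last:
  assumes "R \<in> RB0"
  shows "diagonal_at R n"
proof -
  interpret R: Vector_Spaces.linear scale scale R
    using RB0_linear assms .
  have "(coord m (R (e n)))\<^sup>2 = 0" if "m \<in> {1..<n}" for m
    by (rule square_combination_leading[where q = n])
      (use RB0_basis[OF assms, of n n] n_ge_3 that in
        \<open>auto simp: square_last R.zero power2_eq_square\<close>)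
  then show ?thesis
    by (auto simp: diagonal_at_def)
qed

text \<open>
  The square \<open>e i \<odot> e i\<close> involves only basis vectors beyond \<open>i\<close>, on which \<open>R\<close> is diagonal up to
  multiples of \<open>e n\<close>. These multiples spoil the formula at \<open>p = n\<close>, except for \<open>i = n - 1\<close>, where
  the square is \<open>e n\<close> itself; this is why \<open>p = i + 1\<close> is allowed.
\<close>

lemma coord_image_square:
  assumes "Vector_Spaces.linear scale scale R" "i \<in> {1..<n}"
    and "\<And>j. j \<in> {i<..n} \<Longrightarrow> diagonal_at R j"
    and "p \<in> {1..n}" "p < n \<or> p = i + 1"
  shows "coord p (R (square i)) = coord p (square i) * diag_entry R p"
proof -
  have "coord p (R (square i)) = (\<Sum>j\<in>{1..n}. coord j (square i) * coord p (R (e j)))"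
    by (subst linear_expansion[OF assms(1)]) simp
  also have "\<dots> = coord p (square i) * diag_entry R p"
  proof (rule sum_eq_single)
    fix j assume j: "j \<in> {1..n}" "j \<noteq> p"
    show "coord j (square i) * coord p (R (e j)) = 0"
    proof (cases "i < j")
      case True
      then have "p < n" using assms(5) j by auto
      with True assms(3)[of j] assms(4) j show ?thesis
        by (auto simp: diagonal_at_def)
    next
      case False
      with assms(2) j show ?thesis by (simp add: coord_square)
    qed
  qed (use assms in auto)
  finally show ?thesis .
qed

text \<open>
  The doubling relation is part of the induction because diagonality alone does not propagate: when
  the entry at \<open>i\<close> is nonzero, doubling makes all later diagonal entries nonzero and any two
  neighbours distinct, and this removes the entries of \<open>R (e i)\<close> between \<open>i\<close> and \<open>n\<close>.
\<close>

lemma diagonal_at_step: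
  assumes R: "R \<in> RB0" and i: "i \<in> {1..<n}"
    and diag: "\<And>j. j \<in> {i<..n} \<Longrightarrow> diagonal_at R j"
    and doubling: "\<And>j. j \<in> {i<..<n} \<Longrightarrow> diag_entry R j \<noteq> 0 \<Longrightarrow>
      diag_entry R j = 2 * diag_entry R (j + 1)"
  shows "diagonal_at R i \<and> (diag_entry R i \<noteq> 0 \<longrightarrow> diag_entry R i = 2 * diag_entry R (i + 1))"
proof -
  note image = coord_image_square[OF RB0_linear[OF R]]
  have sq: "(\<Sum>m\<in>{1..<n}. (coord m (R (e i)))\<^sup>2 * coord p (square m)) =
      2 * diag_entry R i * coord p (R (square i))" for p
    using RB0_basis[OF R, of i i p] i by (simp add: power2_eq_square)
  \<comment> \<open>The right-hand side of \<open>sq\<close> has no coordinates up to \<open>i\<close>.\<close>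
  have below: "coord m (R (e i)) = 0" if "m \<in> {1..<i}" for m
  proof -
    have "(coord m (R (e i)))\<^sup>2 = 0"
    proof (rule square_combination_leading[where q = i and g = "\<lambda>m. (coord m (R (e i)))\<^sup>2"])
      show "(\<Sum>m\<in>{1..<n}. (coord m (R (e i)))\<^sup>2 * coord p (square m)) = 0"
        if "p \<in> {1..i}" for p
        unfolding sq using image[of i p] diag i that by (auto simp: coord_square)
    qed (use i that in auto)
    then show ?thesis by simp
  qed
  \<comment> \<open>The coefficient of the leading vector \<open>e (i + 1)\<close> gives a quadratic equation for the entry at \<open>i\<close>.\<close>
  have "(\<Sum>m\<in>{1..<n}. (coord m (R (e i)))\<^sup>2 * coord (i + 1) (square m)) = (diag_entry R i)\<^sup>2"
    by (subst sum_eq_single[where i = i]) (use i below in \<open>auto simp: coord_square\<close>)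
  moreover have "coord (i + 1) (R (square i)) = diag_entry R (i + 1)"
    using image[of i "i + 1"] diag i by (auto simp: coord_square)
  ultimately have quadratic: "(diag_entry R i)\<^sup>2 = 2 * diag_entry R i * diag_entry R (i + 1)"
    using sq[of "i + 1"] by simp
  show ?thesis
  proof (cases "diag_entry R i = 0")
    case True
    have "(coord m (R (e i)))\<^sup>2 = 0" if "m \<in> {1..<n}" for m
      by (rule square_combination_leading[where q = n]) (use sq True that in auto)
    with True show ?thesis by (auto simp: diagonal_at_def)
  next
    case False
    with quadratic have double: "diag_entry R i = 2 * diag_entry R (i + 1)"
      by (simp add: power2_eq_square)
    have nonzero: "diag_entry R j \<noteq> 0" if "j \<in> {i..n}" for j
    proof -
      from that have "i \<le> j" "j \<le> n" by auto
      then show ?thesis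
      proof (induction j rule: dec_induct)
        case base
        show ?case by (rule False)
      next
        case (step j)
        then show ?case using doubling[of j] double by (cases "j = i") auto
      qed
    qed
    \<comment> \<open>The identity on \<open>(e i, e j)\<close>, read off at the leading vector \<open>e (j + 1)\<close> of the square of \<open>e j\<close>.\<close>
    have above: "coord j (R (e i)) = 0" if j: "j \<in> {i<..<n}" for j
    proof -
      have "(\<Sum>m\<in>{1..<n}. coord m (R (e i)) * coord m (R (e j)) * coord (j + 1) (square m)) =
          coord j (R (e i)) * diag_entry R j"
        by (subst sum_eq_single[where i = j])
          (use i j diag[of j] in \<open>auto simp: coord_square diagonal_at_def\<close>)
      moreover have "coord i (R (e j)) = 0"
        using diag[of j] i j by (auto simp: diagonal_at_def)
      moreover have "coord (j + 1) (R (square j)) = diag_entry R (j + 1)"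
        using image[of j "j + 1"] diag i j by (auto simp: coord_square)
      ultimately have "coord j (R (e i)) * diag_entry R j = coord j (R (e i)) * diag_entry R (j + 1)"
        using RB0_basis[OF R, of i j "j + 1"] i j by simp
      moreover have "diag_entry R j = 2 * diag_entry R (j + 1)" "diag_entry R (j + 1) \<noteq> 0"
        using doubling[of j] nonzero[of j] nonzero[of "j + 1"] j by auto
      ultimately show ?thesis by simp
    qed
    have "coord p (R (e i)) = 0" if "p \<in> {1..<n}" "p \<noteq> i" for p
      using below[of p] above[of p] that by (cases p i rule: linorder_cases) auto
    with double show ?thesis by (auto simp: diagonal_at_def)
  qed
qed

lemma RB0_diagonal:
  assumes R: "R \<in> RB0"
  shows RB0_diagonal_at: "i \<in> {1..n} \<Longrightarrow> diagonal_at R i"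
    and RB0_doubling: "i \<in> {1..<n} \<Longrightarrow> diag_entry R i \<noteq> 0 \<Longrightarrow>
      diag_entry R i = 2 * diag_entry R (i + 1)"
proof -
  have main: "diagonal_at R i \<and>
      (i < n \<longrightarrow> diag_entry R i \<noteq> 0 \<longrightarrow> diag_entry R i = 2 * diag_entry R (i + 1))"
    if "i \<in> {1..n}" for i
    using that
  proof (induction "n - i" arbitrary: i rule: less_induct)
    case less
    show ?case
    proof (cases "i = n")
      case True
      then show ?thesis using diagonal_at_last[OF R] by simp
    next
      case False
      have IH: "diagonal_at R j \<and>
          (j < n \<longrightarrow> diag_entry R j \<noteq> 0 \<longrightarrow> diag_entry R j = 2 * diag_entry R (j + 1))"
        if "j \<in> {i<..n}" for j
        using less.hyps[of j] less.prems that by auto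
      have "diagonal_at R i \<and> (diag_entry R i \<noteq> 0 \<longrightarrow> diag_entry R i = 2 * diag_entry R (i + 1))"
        by (rule diagonal_at_step[OF R]) (use IH False less.prems in auto)
      then show ?thesis by blast
    qed
  qed
  show "i \<in> {1..n} \<Longrightarrow> diagonal_at R i"
    using main by blast
  show "i \<in> {1..<n} \<Longrightarrow> diag_entry R i \<noteq> 0 \<Longrightarrow> diag_entry R i = 2 * diag_entry R (i + 1)"
    using main[of i] by auto
qed

lemma RB0_image_basis:
  assumes "R \<in> RB0"
  shows "i \<in> {1..<n} \<Longrightarrow> R (e i) = diag_entry R i *s e i + coord n (R (e i)) *s e n"
    and "R (e n) = diag_entry R n *s e n"
proof -
  show "R (e i) = diag_entry R i *s e i + coord n (R (e i)) *s e n" if "i \<in> {1..<n}"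
  proof (rule eq_if_coord_eq)
    fix p assume "p \<in> {1..n}"
    then show "coord p (R (e i)) = coord p (diag_entry R i *s e i + coord n (R (e i)) *s e n)"
      using RB0_diagonal_at[OF assms, of i] that
      by (cases "p = n") (auto simp: coord_basis diagonal_at_def)
  qed
  show "R (e n) = diag_entry R n *s e n"
  proof (rule eq_if_coord_eq)
    fix p assume "p \<in> {1..n}"
    then show "coord p (R (e n)) = coord p (diag_entry R n *s e n)"
      using diagonal_at_last[OF assms]
      by (cases "p = n") (auto simp: coord_basis diagonal_at_def)
  qed
qed

lemma RB0_diag_entry_power:
  assumes R: "R \<in> RB0" and "i \<in> {1..n}" "diag_entry R i \<noteq> 0" "i \<le> j" "j \<le> n"
  shows "diag_entry R i = 2 ^ (j - i) * diag_entry R j"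
  using \<open>i \<le> j\<close> \<open>j \<le> n\<close>
proof (induction j rule: dec_induct)
  case base
  show ?case by simp
next
  case (step j)
  then have IH: "diag_entry R i = 2 ^ (j - i) * diag_entry R j" by simp
  with assms(3) have "diag_entry R j \<noteq> 0" by auto
  then have "diag_entry R j = 2 * diag_entry R (j + 1)"
    using RB0_doubling[OF R, of j] step assms(2) by auto
  with IH step.hyps show ?case by (simp add: Suc_diff_le)
qed

text \<open>
  The coefficient of \<open>e j\<close> in the identity on \<open>(e i, e i)\<close> gives \<open>d i = 2 * d j\<close> when \<open>a i j \<noteq> 0\<close>,
  whereas doubling along the chain gives \<open>d i = 2 ^ (j - i) * d j\<close> with \<open>j - i \<ge> 2\<close>. In
  characteristic zero these are incompatible for a nonzero \<open>d j\<close>.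
\<close>

lemma RB0_structure_constant_zero:
  assumes R: "R \<in> RB0" and "diag_entry R i \<noteq> 0" "1 \<le> i" "i + 1 < j" "j < n"
  shows "a i j = 0"
proof (rule ccontr)
  assume "a i j \<noteq> 0"
  have i: "i \<in> {1..<n}" using assms by auto
  have "(\<Sum>m\<in>{1..<n}. coord m (R (e i)) * coord m (R (e i)) * coord j (square m)) =
      diag_entry R i * diag_entry R i * a i j"
    by (subst sum_eq_single[where i = i])
      (use assms RB0_diagonal_at[OF R, of i] in \<open>auto simp: coord_square diagonal_at_def\<close>)
  moreover have "coord j (R (square i)) = a i j * diag_entry R j"
    using coord_image_square[OF RB0_linear[OF R] i, of j] RB0_diagonal_at[OF R] assms
    by (auto simp: coord_square)
  ultimately have "diag_entry R i = 2 * diag_entry R j"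
    using RB0_basis[OF R, of i i j] i assms(2) \<open>a i j \<noteq> 0\<close> by simp
  then have "2 ^ (j - i) * diag_entry R j = 2 * diag_entry R j" "diag_entry R j \<noteq> 0"
    using RB0_diag_entry_power[OF R, of i j] assms by auto
  then have "(2::'k) ^ (j - i) = 2 ^ 1" by simp
  \<comment> \<open>Pull the equation of powers back to the natural numbers, where exponents can be compared.\<close>
  then have "of_nat (2 ^ (j - i)) = (of_nat (2 ^ 1) :: 'k)" by simp
  then have "(2::nat) ^ (j - i) = 2 ^ 1" unfolding of_nat_eq_iff .
  then have "j - i = 1" by (rule power_inject_exp[THEN iffD1, rotated]) simp
  with assms show False by simp
qed

text \<open>
  A nonzero first entry would make every later entry nonzero, and then every structure constant
  would vanish.
\<close>

lemma RB0_first_diag_entry_zero: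
  assumes R: "R \<in> RB0" and "index_set n a \<noteq> {}"
  shows "diag_entry R 1 = 0"
proof (rule ccontr)
  assume nz: "diag_entry R 1 \<noteq> 0"
  from assms(2) obtain i j where ij: "1 \<le> i" "i + 1 < j" "j < n" "a i j \<noteq> 0"
    by (auto simp: index_set_def)
  then have "diag_entry R i \<noteq> 0"
    using RB0_diag_entry_power[OF R, of 1 i] nz by auto
  with RB0_structure_constant_zero[OF R] ij show False by blast
qed

lemma basis_last_nonzero: "e n \<noteq> 0"
  using coord_basis[of n n] n_ge_3 by auto

lemma RB0_annihilator_valued:
  assumes R: "R \<in> RB0" and "R (e n) = 0"
  shows "annihilator_valued scale n e (\<lambda>i. coord n (R (e i))) 0 R"
proof -
  have "diag_entry R i = 0" if "i \<in> {1..n}" for i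
    using RB0_diag_entry_power[OF R, of i n] that assms(2) by auto
  then show ?thesis
    using RB0_image_basis(1)[OF R] RB0_linear[OF R] assms(2)
    by (auto simp: annihilator_valued_def)
qed

text \<open>The image of \<open>R\<close> annihilates the algebra, so both sides of the identity vanish.\<close>

lemma annihilator_valued_RB0:
  assumes "annihilator_valued scale n e \<beta> lam R"
  shows "R \<in> RB0"
proof -
  have lin: "Vector_Spaces.linear scale scale R"
    using assms by (simp add: annihilator_valued_def)
  interpret R: Vector_Spaces.linear scale scale R by fact
  have "coord m (R x) = 0" if m: "m \<in> {1..<n}" for m x
  proof -
    have "coord m (R (e i)) = 0" if i: "i \<in> {1..n}" for i
      using assms m i by (cases "i = n") (auto simp: annihilator_valued_def coord_basis)
    then show ?thesis by (subst linear_expansion[OF lin]) simp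
  qed
  then have "R x \<odot> y = 0" "y \<odot> R x = 0" for x y
    by (simp_all add: mult_expansion[of "R x" y] mult_expansion[of y "R x"])
  then show ?thesis
    using lin by (simp add: RB0_def R.zero)
qed

section \<open>Commutators of maps that are diagonal modulo the annihilator\<close>

text \<open>
  The diagonal parts commute, and \<open>e n\<close> is a common eigenvector, so on each \<open>e i\<close> the commutator
  only sees how the \<open>e n\<close>-part of one map interacts with the eigenvalue gap between \<open>i\<close> and \<open>n\<close>
  of the other.
\<close>

lemma
  assumes R: "Vector_Spaces.linear scale scale R" and D: "Vector_Spaces.linear scale scale D"
    and R_basis: "\<And>i. i \<in> {1..<n} \<Longrightarrow> R (e i) = \<rho> i *s e i + \<beta> i *s e n"
    and R_last: "R (e n) = lam *s e n"
    and D_basis: "\<And>i. i \<in> {1..<n} \<Longrightarrow> D (e i) = \<delta> i *s e i + \<tau> i *s e n"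
    and D_last: "D (e n) = \<delta> n *s e n"
  shows commutator_basis: "i \<in> {1..<n} \<Longrightarrow>
      commutator R D (e i) = (\<beta> i * (\<delta> i - \<delta> n) + \<tau> i * (lam - \<rho> i)) *s e n"
    and commutator_eq_0_iff: "commutator R D = (\<lambda>x. 0) \<longleftrightarrow>
      (\<forall>i\<in>{1..<n}. \<beta> i * (\<delta> i - \<delta> n) + \<tau> i * (lam - \<rho> i) = 0)"
proof -
  interpret R: Vector_Spaces.linear scale scale R by fact
  interpret D: Vector_Spaces.linear scale scale D by fact
  show basis: "commutator R D (e i) = (\<beta> i * (\<delta> i - \<delta> n) + \<tau> i * (lam - \<rho> i)) *s e n"
    if "i \<in> {1..<n}" for i
    using that by (simp add: commutator_def R_basis R_last D_basis D_last R.add R.scale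
        D.add D.scale algebra_simps)
  have last: "commutator R D (e n) = 0"
    by (simp add: commutator_def R_last D_last R.scale D.scale mult.commute)
  have "Vector_Spaces.linear scale scale (commutator R D)"
    by unfold_locales
      (simp_all add: commutator_def R.add R.scale D.add D.scale scale_right_diff_distrib)
  then have expansion: "commutator R D x = (\<Sum>i\<in>{1..n}. coord i x *s commutator R D (e i))" for x
    by (rule linear_expansion)
  have "commutator R D = (\<lambda>x. 0)" if "\<forall>i\<in>{1..<n}. commutator R D (e i) = 0"
  proof
    fix x
    have "commutator R D (e i) = 0" if "i \<in> {1..n}" for i
      using that last \<open>\<forall>i\<in>{1..<n}. commutator R D (e i) = 0\<close> by (cases "i = n") auto
    with expansion[of x] show "commutator R D x = 0"
      by simp
  qed
  moreover have "\<forall>i\<in>{1..<n}. commutator R D (e i) = 0" if "commutator R D = (\<lambda>x. 0)"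
    using that by simp
  ultimately show "commutator R D = (\<lambda>x. 0) \<longleftrightarrow>
      (\<forall>i\<in>{1..<n}. \<beta> i * (\<delta> i - \<delta> n) + \<tau> i * (lam - \<rho> i) = 0)"
    using basis basis_last_nonzero by (metis scale_eq_0_iff)
qed

lemma commutator_index_set_nonempty:
  assumes "index_set n a \<noteq> {}" "R \<in> RB0" "Vector_Spaces.linear scale scale D"
    and "D (e 1) = \<nu> *s e n" "\<forall>i\<in>{2..n}. D (e i) = 0"
  shows "commutator R D = (\<lambda>x. 0) \<longleftrightarrow> \<nu> * diag_entry R n = 0"
proof -
  have "commutator R D = (\<lambda>x. 0) \<longleftrightarrow> (\<forall>i\<in>{1..<n}.
      coord n (R (e i)) * (0 - 0) + (if i = 1 then \<nu> else 0) * (diag_entry R n - diag_entry R i) = 0)"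
    by (rule commutator_eq_0_iff[where \<delta> = "\<lambda>_. 0"])
      (use assms n_ge_3 RB0_linear RB0_image_basis in auto)
  then show ?thesis
    using RB0_first_diag_entry_zero[OF assms(2,1)] n_ge_3 by auto
qed

lemma commutator_annihilator_valued:
  assumes "annihilator_valued scale n e \<beta> lam R" "Vector_Spaces.linear scale scale D"
    and "D (e 1) = \<mu> *s e 1 + \<tau> 1 *s e n" "\<forall>i\<in>{2..n}. D (e i) = (2 ^ (i - 1) * \<mu>) *s e i"
    and "\<forall>i\<in>{2..<n}. \<tau> i = 0"
  shows "commutator R D = (\<lambda>x. 0) \<longleftrightarrow>
    (\<forall>i\<in>{1..<n}. \<beta> i * (2 ^ (i - 1) - 2 ^ (n - 1)) * \<mu> + \<tau> i * lam = 0)"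
proof -
  have "D (e i) = (2 ^ (i - 1) * \<mu>) *s e i + \<tau> i *s e n" if "i \<in> {1..<n}" for i
    using assms that by (cases "i = 1") auto
  then have "commutator R D = (\<lambda>x. 0) \<longleftrightarrow> (\<forall>i\<in>{1..<n}.
      \<beta> i * (2 ^ (i - 1) * \<mu> - 2 ^ (n - 1) * \<mu>) + \<tau> i * (lam - 0) = 0)"
    by (intro commutator_eq_0_iff[where \<rho> = "\<lambda>_. 0" and \<delta> = "\<lambda>i. 2 ^ (i - 1) * \<mu>"])
      (use assms n_ge_3 in \<open>auto simp: annihilator_valued_def\<close>)
  then show ?thesis by (simp add: algebra_simps)
qed

lemma commutator_nonzero_threshold:
  assumes R: "nonzero_threshold scale n e a k \<beta> lam R" and D: "Vector_Spaces.linear scale scale D"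
    and D_basis: "D (e 1) = \<mu> *s e 1 + \<tau> 1 *s e n"
      "\<forall>i\<in>{2..n}. D (e i) = (2 ^ (i - 1) * \<mu>) *s e i"
    and \<tau>: "\<forall>i\<in>{2..<n}. \<tau> i = 0"
  shows "(commutator R D = (\<lambda>x. 0) \<longleftrightarrow>
      (\<forall>i\<in>{1..<k}. \<beta> i * (2 ^ (i - 1) - 2 ^ (n - 1)) * \<mu> + \<tau> i * lam = 0) \<and>
      \<beta> k * (2 ^ (k - 1) - 2 ^ (n - 1)) * \<mu> + (1 - 2 ^ (n - k)) * \<tau> k * lam = 0) \<and>
    (\<forall>i\<in>{k<..<n}. commutator R D (e i) = 0)"
proof -
  \<comment> \<open>The single pair \<open>?\<rho>\<close>, \<open>?\<beta>\<close> describes \<open>R\<close> on all three ranges \<open>i < k\<close>, \<open>i = k\<close>, \<open>i > k\<close>.\<close>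
  let ?\<delta> = "\<lambda>i. 2 ^ (i - 1) * \<mu>"
  let ?\<rho> = "\<lambda>i. if i < k then 0 else 2 ^ (n - i) * lam"
  let ?\<beta> = "\<lambda>i. if i \<le> k then \<beta> i else 0"
  let ?c = "\<lambda>i. ?\<beta> i * (?\<delta> i - ?\<delta> n) + \<tau> i * (lam - ?\<rho> i)"
  have k: "1 \<le> k" "k < n"
    using R n_ge_3 by (auto simp: nonzero_threshold_def)
  have R': "R (e i) = ?\<rho> i *s e i + ?\<beta> i *s e n" if "i \<in> {1..<n}" for i
    using R that by (cases i k rule: linorder_cases) (auto simp: nonzero_threshold_def)
  have R_last: "R (e n) = lam *s e n"
    using R k by (auto simp: nonzero_threshold_def)
  have D': "D (e i) = ?\<delta> i *s e i + \<tau> i *s e n" if "i \<in> {1..<n}" for i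
    using D_basis \<tau> that by (cases "i = 1") auto
  have D_last: "D (e n) = ?\<delta> n *s e n"
    using D_basis n_ge_3 by auto
  have R_linear: "Vector_Spaces.linear scale scale R"
    using R by (simp add: nonzero_threshold_def)
  note maps = R_linear D R' R_last D' D_last
  have basis: "commutator R D (e i) = ?c i *s e n" if "i \<in> {1..<n}" for i
    by (rule commutator_basis[OF maps that])
  have iff: "commutator R D = (\<lambda>x. 0) \<longleftrightarrow> (\<forall>i\<in>{1..<n}. ?c i = 0)"
    by (rule commutator_eq_0_iff[OF maps])
  \<comment> \<open>Both parts of \<open>?c i\<close> vanish: \<open>?\<beta> i = 0\<close>, and \<open>\<tau> i = 0\<close> since \<open>i > k \<ge> 1\<close>.\<close>
  have above: "?c i = 0" if "i \<in> {k<..<n}" for i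
    using that \<tau> k by auto
  have below: "?c i = \<beta> i * (2 ^ (i - 1) - 2 ^ (n - 1)) * \<mu> + \<tau> i * lam" if "i \<in> {1..<k}" for i
    using that by (simp add: algebra_simps)
  have at: "?c k = \<beta> k * (2 ^ (k - 1) - 2 ^ (n - 1)) * \<mu> + (1 - 2 ^ (n - k)) * \<tau> k * lam"
    by (simp add: algebra_simps)
  have "{1..<n} = {1..<k} \<union> {k} \<union> {k<..<n}"
    using k by auto
  then have "(\<forall>i\<in>{1..<n}. ?c i = 0) \<longleftrightarrow> (\<forall>i\<in>{1..<k}. ?c i = 0) \<and> ?c k = 0"
    using above by (metis (no_types, lifting) Un_iff singletonD singletonI)
  moreover have "(\<forall>i\<in>{1..<k}. ?c i = 0) \<longleftrightarrow>
      (\<forall>i\<in>{1..<k}. \<beta> i * (2 ^ (i - 1) - 2 ^ (n - 1)) * \<mu> + \<tau> i * lam = 0)"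
    by (rule ball_cong[OF refl]) (simp only: below)
  moreover have "commutator R D (e i) = 0" if "i \<in> {k<..<n}" for i
    using basis[of i] above[OF that] that k by simp
  ultimately show ?thesis
    using iff at by auto
qed

end

section \<open>Rota--Baxter operators commuting with a derivation\<close>

theorem theorem6p3:
  fixes scale :: "'k::field_char_0 \<Rightarrow> 'v::ab_group_add \<Rightarrow> 'v"
    and mult :: "'v \<Rightarrow> 'v \<Rightarrow> 'v"
    and n :: nat
    and e :: "nat \<Rightarrow> 'v"
    and a :: "nat \<Rightarrow> nat \<Rightarrow> 'k"
    and D :: "'v \<Rightarrow> 'v"
  assumes "n \<ge> 3"
    and "max_nilindex_evolution_algebra scale mult n"
    and "normal_form scale mult n e a"
    and "D \<in> nonassoc_algebra.Der scale mult"
  shows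
    "(index_set n a \<noteq> {} \<longrightarrow>
       (\<forall>\<nu>. D (e 1) = scale \<nu> (e n) \<and> (\<forall>i\<in>{2..n}. D (e i) = 0) \<longrightarrow>
         (\<forall>R \<in> nonassoc_algebra.RB0 scale mult.
            commutator R D = (\<lambda>x. 0) \<longleftrightarrow> \<nu> * basis_coeff scale n e n (R (e n)) = 0) \<and>
         (\<nu> = 0 \<longrightarrow>
            (\<forall>R \<in> nonassoc_algebra.RB0 scale mult. commutator R D = (\<lambda>x. 0))) \<and>
         (\<nu> \<noteq> 0 \<longrightarrow>
            {R \<in> nonassoc_algebra.RB0 scale mult. commutator R D = (\<lambda>x. 0)} =
            {R. (\<exists>\<beta> lam. annihilator_valued scale n e \<beta> lam R) \<and> R (e n) = 0}))) \<and>
     (index_set n a = {} \<longrightarrow>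
       (\<forall>\<mu> \<nu> \<tau>.
         D (e 1) = scale \<mu> (e 1) + scale \<nu> (e n) \<and>
         (\<forall>i\<in>{2..n}. D (e i) = scale (2 ^ (i - 1) * \<mu>) (e i)) \<and>
         \<tau> 1 = \<nu> \<and> (\<forall>i\<in>{2..<n}. \<tau> i = 0) \<longrightarrow>
         (\<forall>R \<in> nonassoc_algebra.RB0 scale mult. \<forall>\<beta> lam.
            annihilator_valued scale n e \<beta> lam R \<longrightarrow>
            (commutator R D = (\<lambda>x. 0) \<longleftrightarrow>
             (\<forall>i\<in>{1..<n}. \<beta> i * (2 ^ (i - 1) - 2 ^ (n - 1)) * \<mu> + \<tau> i * lam = 0))) \<and>
         (\<forall>R \<in> nonassoc_algebra.RB0 scale mult. \<forall>k \<beta> lam.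
            nonzero_threshold scale n e a k \<beta> lam R \<longrightarrow>
            (commutator R D = (\<lambda>x. 0) \<longleftrightarrow>
             (\<forall>i\<in>{1..<k}. \<beta> i * (2 ^ (i - 1) - 2 ^ (n - 1)) * \<mu> + \<tau> i * lam = 0) \<and>
             \<beta> k * (2 ^ (k - 1) - 2 ^ (n - 1)) * \<mu> + (1 - 2 ^ (n - k)) * \<tau> k * lam = 0) \<and>
            (\<forall>i\<in>{k<..<n}. commutator R D (e i) = 0))))"
proof -
  interpret nonassoc_algebra scale mult
    using assms(2) by (simp add: max_nilindex_evolution_algebra_def)
  interpret normal_form_algebra scale mult n e a
    by unfold_locales (use assms in auto)
  have D: "Vector_Spaces.linear scale scale D"
    using assms(4) by (simp add: Der_def)
  show ?thesis
  proof (intro conjI impI allI)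
    fix \<nu>
    assume ne: "index_set n a \<noteq> {}"
      and "D (e 1) = scale \<nu> (e n) \<and> (\<forall>i\<in>{2..n}. D (e i) = 0)"
    then have iff: "commutator R D = (\<lambda>x. 0) \<longleftrightarrow> \<nu> * diag_entry R n = 0" if "R \<in> RB0" for R
      using commutator_index_set_nonempty[OF ne that D] by blast
    show "\<forall>R\<in>RB0. commutator R D = (\<lambda>x. 0) \<longleftrightarrow> \<nu> * diag_entry R n = 0"
      using iff by blast
    show "\<forall>R\<in>RB0. commutator R D = (\<lambda>x. 0)" if "\<nu> = 0"
      using iff that by auto
    show "{R \<in> RB0. commutator R D = (\<lambda>x. 0)} =
        {R. (\<exists>\<beta> lam. annihilator_valued scale n e \<beta> lam R) \<and> R (e n) = 0}" if "\<nu> \<noteq> 0"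
    proof -
      have "diag_entry R n = 0 \<longleftrightarrow> R (e n) = 0" if "R \<in> RB0" for R
        using RB0_image_basis(2)[OF that] basis_last_nonzero by (metis scale_eq_0_iff)
      then have "R \<in> RB0 \<and> commutator R D = (\<lambda>x. 0) \<longleftrightarrow> R \<in> RB0 \<and> R (e n) = 0" for R
        using iff that by auto
      then show ?thesis
        using RB0_annihilator_valued annihilator_valued_RB0 by blast
    qed
  next
    fix \<mu> \<nu> \<tau>
    assume "D (e 1) = scale \<mu> (e 1) + scale \<nu> (e n) \<and>
         (\<forall>i\<in>{2..n}. D (e i) = scale (2 ^ (i - 1) * \<mu>) (e i)) \<and>
         \<tau> 1 = \<nu> \<and> (\<forall>i\<in>{2..<n}. \<tau> i = 0)"
    then have D_basis: "D (e 1) = scale \<mu> (e 1) + scale (\<tau> 1) (e n)"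
      "\<forall>i\<in>{2..n}. D (e i) = scale (2 ^ (i - 1) * \<mu>) (e i)" "\<forall>i\<in>{2..<n}. \<tau> i = 0"
      by auto
    show "\<forall>R\<in>RB0. \<forall>\<beta> lam. annihilator_valued scale n e \<beta> lam R \<longrightarrow>
        (commutator R D = (\<lambda>x. 0) \<longleftrightarrow>
         (\<forall>i\<in>{1..<n}. \<beta> i * (2 ^ (i - 1) - 2 ^ (n - 1)) * \<mu> + \<tau> i * lam = 0))"
      using commutator_annihilator_valued[OF _ D D_basis] by blast
    show "\<forall>R\<in>RB0. \<forall>k \<beta> lam. nonzero_threshold scale n e a k \<beta> lam R \<longrightarrow>
        (commutator R D = (\<lambda>x. 0) \<longleftrightarrow>
         (\<forall>i\<in>{1..<k}. \<beta> i * (2 ^ (i - 1) - 2 ^ (n - 1)) * \<mu> + \<tau> i * lam = 0) \<and>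
         \<beta> k * (2 ^ (k - 1) - 2 ^ (n - 1)) * \<mu> + (1 - 2 ^ (n - k)) * \<tau> k * lam = 0) \<and>
        (\<forall>i\<in>{k<..<n}. commutator R D (e i) = 0)"
      using commutator_nonzero_threshold[OF _ D D_basis] by blast
  qed
qed

end
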